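(* Let $\theta\in(0,\pi/2)$ and consider any hierarchical tiling with basic angle $\theta$. The number of orientations in which the basic triangle appears in the tiling is finite if $\theta/\pi$ is rational and infinite if $\theta/\pi$ is irrational.
   Context: Fix positive reals $a,b,c$ with $a^2+b^2=c^2$ and let $\theta=\arcsin(a/c)\in(0,\pi/2)$. A tile is a right triangle with an ordered triple of vertices $(A,C,B)$, with right angle at $C$ and angle $\theta$ at $A$, so that $|AC|:|CB|:|AB|=b:a:c$. $AC$ is called the long leg and $CB$ the short leg (even if $b\le a$). Subdivision rule: let $F$ be the foot of the perpendicular from $C$ to $AB$, and let $M,N,K$ be the midpoints of $AC$, $AF$, $FC$. The tile $(A,C,B)$ is divided into the five daughter tiles $(A,N,M)$, $(M,K,C)$, $(M,K,F)$, $(F,N,M)$ (each smaller than the parent by the linear factor $b/(2c)$) and $(C,F,B)$ (smaller by the linear factor $a/c$). Let $T$ be the basic tile with hypotenuse $c$. Put $T_0=\{T\}$, and for $n\ge1$ let $T_n$ be obtained from $T_{n-1}$ by subdividing every tile of $T_{n-1}$ that has the largest hypotenuse occurring in $T_{n-1}$. A supertile of order $n$ is a collection of tiles of the form $e(s(T_n))$, where $s$ is a rescaling and $e$ is a Euclidean motion (possibly orientation reversing). A hierarchical tiling with basic angle $\theta$ is a tiling of an infinite region (typically the whole plane) that is the union of supertiles $S_1\subsetneq S_2\subsetneq\cdots$ of orders $N_1<N_2<\cdots$, where for each $i$, writing $S_{i+1}=e(s(T_{N_{i+1}}))$, there are $n\le N_{i+1}$ and a tile $t\in T_n$ such that $S_i$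 is the image under $e\circ s$ of the set of tiles of $T_{N_{i+1}}$ contained in $t$. The orientation of a tile is the element $g\in O(2)$ such that the tile is (respecting the vertex labels) a translate of a positive multiple of $g(T)$. *)

theory Defs
  imports "HOL-Analysis.Analysis"
begin

text \<open>A labelled triangle is the ordered triple \<open>(A, C, B)\<close> of its vertices,
  with the right angle at the middle entry \<open>C\<close>.\<close>

type_synonym point = "real^2"
type_synonym triangle = "point \<times> point \<times> point"

fun is_tile :: "real \<Rightarrow> real \<Rightarrow> real \<Rightarrow> triangle \<Rightarrow> bool" where
  "is_tile a b c (A, C, B) \<longleftrightarrow>
     orthogonal (A - C) (B - C) \<and>
     (\<exists>r>0. dist A C = r * b \<and> dist C B = r * a \<and> dist A B = r * c)"

fun hypotenuse :: "triangle \<Rightarrow> real" where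
  "hypotenuse (A, C, B) = dist A B"

fun region :: "triangle \<Rightarrow> point set" where
  "region (A, C, B) = convex hull {A, C, B}"

fun map_triangle :: "(point \<Rightarrow> point) \<Rightarrow> triangle \<Rightarrow> triangle" where
  "map_triangle f (A, C, B) = (f A, f C, f B)"

text \<open>Foot of the perpendicular from \<open>C\<close> to the line through \<open>A\<close> and \<open>B\<close>; see the next two lemmas.\<close>

definition foot :: "point \<Rightarrow> point \<Rightarrow> point \<Rightarrow> point" where
  "foot A C B = A + (((C - A) \<bullet> (B - A)) / ((B - A) \<bullet> (B - A))) *\<^sub>R (B - A)"

lemma foot_on_line: "foot A C B \<in> affine hull {A, B}"
proof -
  define k where "k = ((C - A) \<bullet> (B - A)) / ((B - A) \<bullet> (B - A))"
  have "foot A C B = A + k *\<^sub>R (B - A)"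
    unfolding foot_def k_def ..
  also have "\<dots> = (1 - k) *\<^sub>R A + k *\<^sub>R B"
    by (simp add: algebra_simps)
  finally have "foot A C B = (1 - k) *\<^sub>R A + k *\<^sub>R B" .
  then show ?thesis
    unfolding affine_hull_2 by (intro CollectI exI[of _ "1 - k"] exI[of _ k]) auto
qed

lemma foot_perpendicular:
  assumes "A \<noteq> B"
  shows "orthogonal (C - foot A C B) (B - A)"
proof -
  have "(B - A) \<bullet> (B - A) \<noteq> 0"
    using assms by simp
  then have "(foot A C B - A) \<bullet> (B - A) = (C - A) \<bullet> (B - A)"
    unfolding foot_def by (simp del: inner_eq_zero_iff)
  then show ?thesis
    by (simp add: orthogonal_def inner_diff_left)
qed

fun daughters :: "triangle \<Rightarrow> triangle set" where
  "daughters (A, C, B) =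
    (let F = foot A C B; M = midpoint A C; N = midpoint A F; K = midpoint F C
     in {(A, N, M), (M, K, C), (M, K, F), (F, N, M), (C, F, B)})"

primrec subdivision :: "triangle \<Rightarrow> nat \<Rightarrow> triangle set" where
  "subdivision T 0 = {T}"
| "subdivision T (Suc n) =
    (\<Union>t\<in>subdivision T n.
       if hypotenuse t = Max (hypotenuse ` subdivision T n) then daughters t else {t})"

definition euclidean_motion :: "(point \<Rightarrow> point) \<Rightarrow> bool" where
  "euclidean_motion e \<longleftrightarrow> (\<exists>g v. orthogonal_transformation g \<and> e = (\<lambda>x. v + g x))"

text \<open>Translations are part of the motion, so it suffices to rescale about the origin.\<close>

definition rescaling :: "(point \<Rightarrow> point) \<Rightarrow> bool" where
  "rescaling s \<longleftrightarrow> (\<exists>r>0. s = (\<lambda>x. r *\<^sub>R x))"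

definition supertile :: "triangle \<Rightarrow> nat \<Rightarrow> triangle set \<Rightarrow> bool" where
  "supertile T n S \<longleftrightarrow>
    (\<exists>e s. euclidean_motion e \<and> rescaling s \<and> S = map_triangle (e \<circ> s) ` subdivision T n)"

definition is_tiling :: "real \<Rightarrow> real \<Rightarrow> real \<Rightarrow> triangle set \<Rightarrow> point set \<Rightarrow> bool" where
  "is_tiling a b c X R \<longleftrightarrow>
    (\<forall>t\<in>X. is_tile a b c t) \<and>
    (\<Union>t\<in>X. region t) = R \<and>
    pairwise (\<lambda>t u. interior (region t) \<inter> interior (region u) = {}) X"

text \<open>The infinite region is read as an unbounded one.
  The chain of supertiles is indexed from \<open>0\<close>.\<close>

definition hierarchical_tiling ::
  "real \<Rightarrow> real \<Rightarrow> real \<Rightarrow> triangle \<Rightarrow> triangle set \<Rightarrow> bool" where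
  "hierarchical_tiling a b c T X \<longleftrightarrow>
    (\<exists>R. \<not> bounded R \<and> is_tiling a b c X R) \<and>
    (\<exists>(S :: nat \<Rightarrow> triangle set) (N :: nat \<Rightarrow> nat).
       X = (\<Union>i. S i) \<and> strict_mono N \<and>
       (\<forall>i. supertile T (N i) (S i)) \<and>
       (\<forall>i. S i \<subset> S (Suc i)) \<and>
       (\<forall>i. \<exists>e s. euclidean_motion e \<and> rescaling s \<and>
          S (Suc i) = map_triangle (e \<circ> s) ` subdivision T (N (Suc i)) \<and>
          (\<exists>n\<le>N (Suc i). \<exists>t\<in>subdivision T n.
             S i = map_triangle (e \<circ> s) `
               {u \<in> subdivision T (N (Suc i)). region u \<subseteq> region t})))"

definition has_orientation :: "triangle \<Rightarrow> triangle \<Rightarrow> (point \<Rightarrow> point) \<Rightarrow> bool" where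
  "has_orientation T t g \<longleftrightarrow>
    orthogonal_transformation g \<and>
    (\<exists>r>0. \<exists>v. t = map_triangle (\<lambda>x. v + r *\<^sub>R g x) T)"

definition orientations :: "triangle \<Rightarrow> triangle set \<Rightarrow> (point \<Rightarrow> point) set" where
  "orientations T X = {g. \<exists>t\<in>X. has_orientation T t g}"

end

theory Submission
  imports Defs
begin

text \<open>Describe a tile by the direction \<open>\<alpha>\<close> of its long leg and its handedness \<open>h = \<plusminus>1\<close>. Every daughter has
  long leg direction \<open>\<alpha> - h\<theta>\<close> up to a multiple of \<open>\<pi>/2\<close>, so all directions in a supertile lie in one
  coset of \<open>\<int>\<theta> + \<int>\<pi>/2\<close>, which is finite modulo \<open>2\<pi>\<close> if \<open>\<theta>/\<pi>\<close> is rational. For irrational \<open>\<theta>/\<pi>\<close>,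
  descending \<open>j\<close> times into a daughter of the same handedness and then forever into one of opposite handedness
  ends, in every sufficiently late subdivision, at a tile turned by \<open>j\<theta>\<close> or \<open>(j + 1)\<theta>\<close>;
  hence a supertile of large order contains many directions.\<close>

section \<open>Unit vectors and linear isometries of the plane\<close>

definition dir :: "real \<Rightarrow> real^2" where
  "dir \<alpha> = vector [cos \<alpha>, sin \<alpha>]"

lemma dir_nth [simp]: "dir \<alpha> $ 1 = cos \<alpha>" "dir \<alpha> $ 2 = sin \<alpha>"
  by (simp_all add: dir_def)

lemma vec2_eq_iff: "(x :: real^2) = y \<longleftrightarrow> x $ 1 = y $ 1 \<and> x $ 2 = y $ 2"
  by (simp add: vec_eq_iff forall_2)

lemma inner_vec2: "(x :: real^2) \<bullet> y = x $ 1 * y $ 1 + x $ 2 * y $ 2"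
  by (simp add: inner_vec_def sum_2)

lemma inner_dir: "dir \<alpha> \<bullet> dir \<beta> = cos (\<alpha> - \<beta>)"
  by (simp add: inner_vec2 cos_diff)

lemma norm_dir [simp]: "norm (dir \<alpha>) = 1"
  by (simp add: norm_eq_sqrt_inner inner_dir)

lemma dir_eq_iff: "dir \<alpha> = dir \<beta> \<longleftrightarrow> (\<exists>k::int. \<alpha> = \<beta> + 2 * pi * k)"
  unfolding vec2_eq_iff dir_nth using sin_cos_eq_iff[of \<alpha> \<beta>] by blast

lemma polar_vec2: obtains \<alpha> where "(v :: real^2) = norm v *\<^sub>R dir \<alpha>"
proof (cases "v = 0")
  case True
  show ?thesis by (rule that[of 0]) (simp add: True)
next
  case False
  have "(norm v)\<^sup>2 = v $ 1 * v $ 1 + v $ 2 * v $ 2"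
    unfolding power2_norm_eq_inner by (rule inner_vec2)
  with False have "(v $ 1 / norm v)\<^sup>2 + (v $ 2 / norm v)\<^sup>2 = 1"
    unfolding power_divide add_divide_distrib[symmetric] power2_eq_square[of "_ $ _"] by auto
  then obtain \<alpha> where "0 \<le> \<alpha>" "\<alpha> < 2 * pi"
      and \<alpha>: "v $ 1 / norm v = cos \<alpha>" "v $ 2 / norm v = sin \<alpha>"
    by (rule sincos_total_2pi)
  have "v = norm v *\<^sub>R dir \<alpha>"
    using False by (simp add: vec2_eq_iff \<alpha>[symmetric])
  then show ?thesis by (rule that)
qed

text \<open>The two unit vectors form an orthonormal basis. A linear map is therefore determined by
  its values on them, which lets an orientation be recorded as a pair of vectors.\<close>

lemma expand_dir:
  "v = (v \<bullet> dir \<alpha>) *\<^sub>R dir \<alpha> + (v \<bullet> dir (\<alpha> - pi / 2)) *\<^sub>R dir (\<alpha> - pi / 2)"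
proof -
  have "x = (x * cos \<alpha> + y * sin \<alpha>) * cos \<alpha> + (x * sin \<alpha> - y * cos \<alpha>) * sin \<alpha>"
    "y = (x * cos \<alpha> + y * sin \<alpha>) * sin \<alpha> - (x * sin \<alpha> - y * cos \<alpha>) * cos \<alpha>" for x y
    using sin_cos_squared_add[of \<alpha>] by algebra+
  then show ?thesis by (simp add: vec2_eq_iff inner_vec2 cos_diff sin_diff)
qed

text \<open>The orthogonal complement of a line in the plane is one-dimensional, so only a length
  and a sign remain free. The sign becomes the handedness of a tile or the determinant of an
  isometry.\<close>

lemma perpendicular_dir:
  assumes "dir \<alpha> \<bullet> v = 0"
  obtains h where "h \<in> {1, -1}" "v = (norm v * h) *\<^sub>R dir (\<alpha> - pi / 2)"
proof (cases "v = 0")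
  case False
  obtain \<beta> where \<beta>: "v = norm v *\<^sub>R dir \<beta>" by (rule polar_vec2)
  have "norm v * cos (\<alpha> - \<beta>) = 0"
    using assms by (subst (asm) \<beta>) (simp add: inner_dir)
  with False have c: "cos (\<alpha> - \<beta>) = 0" by simp
  define \<gamma> where "\<gamma> = \<alpha> - \<beta>"
  define h where "h = sin \<gamma>"
  have "h\<^sup>2 = 1" using sin_cos_squared_add[of \<gamma>] c by (simp add: h_def \<gamma>_def)
  then have "h \<in> {1, -1}" by (simp add: power2_eq_1_iff)
  have "dir \<beta> = dir (\<alpha> - \<gamma>)" by (simp add: \<gamma>_def)
  also have "\<dots> = h *\<^sub>R dir (\<alpha> - pi / 2)"
    using c by (simp add: vec2_eq_iff cos_diff sin_diff h_def \<gamma>_def[symmetric])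
  finally have "v = (norm v * h) *\<^sub>R dir (\<alpha> - pi / 2)"
    using \<beta> by simp
  with \<open>h \<in> {1, -1}\<close> show ?thesis by (rule that)
next
  case True
  show ?thesis by (rule that[of 1]) (simp_all add: True)
qed

text \<open>An orthonormal pair goes to an orthonormal pair: the image of \<open>dir 0\<close> fixes
  \<beta>, and the image of \<open>dir (- (pi / 2))\<close> leaves only a sign, \<open>1\<close> for
  rotations and \<open>-1\<close> for reflections.\<close>

lemma orthogonal_transformation_dir:
  assumes "orthogonal_transformation g"
  obtains k \<beta> where "k \<in> {1, -1 :: real}" "\<forall>\<alpha>. g (dir \<alpha>) = dir (\<beta> + k * \<alpha>)"
proof -
  have lin: "linear g" and ip: "\<And>v w. g v \<bullet> g w = v \<bullet> w"
    using assms by (auto simp: orthogonal_transformation_def)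
  have nrm: "norm (g v) = norm v" for v
    by (simp add: norm_eq_sqrt_inner ip)
  obtain \<beta> where "g (dir 0) = norm (g (dir 0)) *\<^sub>R dir \<beta>" by (rule polar_vec2)
  then have \<beta>: "g (dir 0) = dir \<beta>" by (simp add: nrm)
  have "dir \<beta> \<bullet> g (dir (- (pi / 2))) = 0"
    by (simp add: \<beta>[symmetric] ip inner_dir)
  then obtain k where k: "k \<in> {1, -1}"
    and "g (dir (- (pi / 2))) = (norm (g (dir (- (pi / 2)))) * k) *\<^sub>R dir (\<beta> - pi / 2)"
    by (rule perpendicular_dir)
  then have k2: "g (dir (- (pi / 2))) = k *\<^sub>R dir (\<beta> - pi / 2)" by (simp add: nrm)
  have "g (dir \<alpha>) = dir (\<beta> + k * \<alpha>)" for \<alpha>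
  proof -
    have "dir \<alpha> = cos \<alpha> *\<^sub>R dir 0 + (- sin \<alpha>) *\<^sub>R dir (- (pi / 2))"
      by (simp add: vec2_eq_iff)
    then have "g (dir \<alpha>) = cos \<alpha> *\<^sub>R dir \<beta> + (- sin \<alpha> * k) *\<^sub>R dir (\<beta> - pi / 2)"
      using lin by (simp only: linear_add linear_scale \<beta> k2 scaleR_scaleR)
    also have "\<dots> = dir (\<beta> + k * \<alpha>)"
      using k by (auto simp: vec2_eq_iff cos_add sin_add cos_diff sin_diff)
    finally show ?thesis .
  qed
  with k show ?thesis by (blast intro: that)
qed

text \<open>This converse supplies the orthogonal part of a similarity between two given
  tiles.\<close>

lemma orthogonal_transformation_dir_exists:
  assumes "k \<in> {1, -1 :: real}"
  obtains g where "orthogonal_transformation g" "\<forall>\<alpha>. g (dir \<alpha>) = dir (\<beta> + k * \<alpha>)"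
proof -
  define g :: "real^2 \<Rightarrow> real^2" where
    "g v = v $ 1 *\<^sub>R dir \<beta> + (k * v $ 2) *\<^sub>R dir (\<beta> + pi / 2)" for v
  have k: "k * k = 1" using assms by auto
  have "linear g"
    by (intro linearI) (simp_all add: g_def algebra_simps)
  moreover have "g v \<bullet> g w = v \<bullet> w" for v w
  proof -
    have "g v \<bullet> g w = v $ 1 * w $ 1 + (k * k) * (v $ 2 * w $ 2)"
      by (simp add: g_def inner_add_left inner_add_right inner_dir)
    then show ?thesis by (simp add: k inner_vec2)
  qed
  ultimately have "orthogonal_transformation g" by (simp add: orthogonal_transformation_def)
  moreover have "\<forall>\<alpha>. g (dir \<alpha>) = dir (\<beta> + k * \<alpha>)"
    using assms by (auto simp: g_def vec2_eq_iff cos_add sin_add cos_diff sin_diff)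
  ultimately show ?thesis by (rule that)
qed

text \<open>If \<theta> = \<open>r * pi / s\<close>, then both \<theta> and \<open>pi / 2\<close>
  are integer multiples of \<open>pi / (2 * s)\<close>, and \<open>4 * s\<close> such steps make a
  full turn.\<close>

lemma finite_dir_coset:
  assumes "\<theta> / pi \<in> \<rat>"
  shows "finite {dir (\<alpha> + of_int m * \<theta> + of_int q * (pi / 2)) | m q. True}" (is "finite ?D")
proof -
  obtain r s :: int where s: "s > 0" and rs: "\<theta> / pi = r / s"
    using assms by (metis Rats_cases' of_int_0_less_iff)
  have th: "\<theta> = r * pi / s" using rs by (simp add: field_simps)
  have "?D \<subseteq> (\<lambda>i::int. dir (\<alpha> + i * pi / (2 * s))) ` {0..<4 * s}"
  proof safe
    fix m q :: int
    define i where "i = 2 * m * r + q * s"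
    define j k where "j = i mod (4 * s)" and "k = i div (4 * s)"
    have "i = j + 4 * s * k" unfolding j_def k_def by (metis mod_mult_div_eq)
    then have i: "real_of_int i = j + 4 * s * k" by simp
    have "\<alpha> + m * \<theta> + q * (pi / 2) = \<alpha> + i * pi / (2 * s)"
      using s by (simp add: th i_def field_simps)
    also have "\<dots> = (\<alpha> + j * pi / (2 * s)) + 2 * pi * k"
      using s by (simp add: i field_simps)
    finally have "dir (\<alpha> + m * \<theta> + q * (pi / 2)) = dir (\<alpha> + j * pi / (2 * s))"
      unfolding dir_eq_iff by blast
    moreover have "j \<in> {0..<4 * s}" using s by (simp add: j_def)
    ultimately show "dir (\<alpha> + m * \<theta> + q * (pi / 2)) \<in> (\<lambda>i::int. dir (\<alpha> + i * pi / (2 * s))) ` {0..<4 * s}"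
      by blast
  qed
  then show ?thesis by (rule finite_subset) simp
qed

section \<open>Tiles given by position, direction, handedness and scale, and their daughters\<close>

text \<open>Signs are kept as reals; recast as integers, they can multiply the coefficients of
  \<theta> and \<open>pi / 2\<close> without leaving the integers.\<close>

lemma sign_of_int: "k \<in> {1, -1 :: real} \<Longrightarrow> \<exists>K::int. k = K"
  by (elim insertE emptyE) (auto intro: exI[of _ 1] exI[of _ "- 1"])

text \<open>\<open>tri p \<alpha> h r\<close> is the tile of scale \<open>r\<close> whose long leg starts at \<open>p\<close> in direction \<open>\<alpha>\<close>;
  the sign \<open>h\<close> is its handedness.\<close>

locale basic_tile =
  fixes a b c \<theta> :: real
  assumes c: "0 < c" and \<theta>: "0 < \<theta>" "\<theta> < pi / 2"
    and ab: "a = c * sin \<theta>" "b = c * cos \<theta>"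
begin

definition tri :: "point \<Rightarrow> real \<Rightarrow> real \<Rightarrow> real \<Rightarrow> triangle" where
  "tri p \<alpha> h r = (p, p + (r * b) *\<^sub>R dir \<alpha>,
     p + (r * b) *\<^sub>R dir \<alpha> + (r * a * h) *\<^sub>R dir (\<alpha> - pi / 2))"

lemma sin_pos: "0 < sin \<theta>" and cos_pos: "0 < cos \<theta>"
  using \<theta> by (auto intro: sin_gt_zero cos_gt_zero)

lemma sin_less_1: "sin \<theta> < 1"
  using cos_pos sin_cos_squared_add[of \<theta>]
  by (smt (verit, best) sin_le_one power_one zero_less_power)

lemma pos: "0 < a" "0 < b"
  using c sin_pos cos_pos by (simp_all add: ab)

text \<open>The polar angle of the long leg gives \<alpha>, and the side on which the short leg
  leaves it gives \<open>h\<close>.\<close>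

lemma is_tile_tri:
  assumes "is_tile a b c t"
  obtains p \<alpha> h r where "h \<in> {1, -1}" "r > 0" "t = tri p \<alpha> h r"
proof -
  obtain A C B where t: "t = (A, C, B)" by (cases t) auto
  obtain r where o: "orthogonal (A - C) (B - C)" and r: "r > 0" "dist A C = r * b" "dist C B = r * a"
    using assms by (auto simp: t)
  obtain \<alpha> where "C - A = norm (C - A) *\<^sub>R dir \<alpha>" by (rule polar_vec2)
  then have \<alpha>: "C - A = (r * b) *\<^sub>R dir \<alpha>" by (metis r(2) dist_norm dist_commute)
  have "(C - A) \<bullet> (B - C) = 0" using o by (simp add: orthogonal_def inner_diff_left)
  then have "dir \<alpha> \<bullet> (B - C) = 0" using r pos by (simp add: \<alpha>)
  then obtain h where h: "h \<in> {1, -1}" "B - C = (norm (B - C) * h) *\<^sub>R dir (\<alpha> - pi / 2)"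
    by (rule perpendicular_dir)
  then have "B - C = (r * a * h) *\<^sub>R dir (\<alpha> - pi / 2)" by (metis r(3) dist_norm dist_commute)
  then have "t = tri A \<alpha> h r" using \<alpha> unfolding t tri_def by (metis add.commute diff_add_cancel)
  with h(1) r(1) show ?thesis by (rule that)
qed

text \<open>The angle between long leg and hypotenuse is \<theta>, so the hypotenuse is the long leg
  turned by \<theta> towards the short leg. This is the source of \<open>- h * \<theta>\<close> in
  every daughter.\<close>

lemma tri_hypotenuse_vector:
  assumes "h \<in> {1, -1}"
  shows "(r * b) *\<^sub>R dir \<alpha> + (r * a * h) *\<^sub>R dir (\<alpha> - pi / 2) = (r * c) *\<^sub>R dir (\<alpha> - h * \<theta>)"
  using assms by (auto simp: vec2_eq_iff ab cos_diff sin_diff cos_add sin_add algebra_simps)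

lemma hypotenuse_tri:
  assumes "h \<in> {1, -1}" "r > 0"
  shows "hypotenuse (tri p \<alpha> h r) = r * c"
  using tri_hypotenuse_vector[OF assms(1), of r \<alpha>] assms(2) c
  by (simp add: tri_def dist_norm add.assoc norm_minus_commute)

text \<open>The long leg has length \<open>r * b\<close> and meets the hypotenuse at the angle
  \<theta>, so its projection has length \<open>r * b * cos \<theta>\<close>.\<close>

lemma foot_tri:
  assumes "h \<in> {1, -1}" "r > 0"
  shows "foot p (p + (r * b) *\<^sub>R dir \<alpha>)
           (p + (r * b) *\<^sub>R dir \<alpha> + (r * a * h) *\<^sub>R dir (\<alpha> - pi / 2))
       = p + (r * b * cos \<theta>) *\<^sub>R dir (\<alpha> - h * \<theta>)"
proof -
  have "cos (h * \<theta>) = cos \<theta>" using assms by auto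
  moreover have "r * b * (r * c * cos \<theta>) / (r * c * (r * c)) * (r * c) = r * b * cos \<theta>"
    using assms c by (simp add: field_simps)
  ultimately show ?thesis
    using c by (simp add: foot_def add.assoc tri_hypotenuse_vector[OF assms(1)] inner_dir)
qed

text \<open>\<open>AN\<close> and \<open>FN\<close> lie on the hypotenuse, \<open>MK\<close> is
  parallel to it as a midline of \<open>AFC\<close>, and \<open>CF\<close> is perpendicular to it;
  this gives the five directions. The proof compares coordinates in the frame \<open>u\<close>,
  \<open>u'\<close> along and across the hypotenuse.\<close>

lemma daughters_tri:
  fixes p :: point and \<alpha> h r :: real
  assumes "h \<in> {1, -1}" "r > 0"
  defines "C \<equiv> p + (r * b) *\<^sub>R dir \<alpha>"
    and "F \<equiv> p + (r * b * cos \<theta>) *\<^sub>R dir (\<alpha> - h * \<theta>)"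
  defines "M \<equiv> midpoint p C" and "\<rho> \<equiv> r * (cos \<theta> / 2)"
  shows "daughters (tri p \<alpha> h r) =
    {tri p (\<alpha> - h * \<theta>) (- h) \<rho>, tri M (\<alpha> - h * \<theta>) (- h) \<rho>, tri M (\<alpha> - h * \<theta>) h \<rho>,
     tri F (\<alpha> - h * \<theta> + pi) h \<rho>, tri C (\<alpha> - h * \<theta> - h * (pi / 2)) (- h) (r * sin \<theta>)}"
proof -
  define B where "B = C + (r * a * h) *\<^sub>R dir (\<alpha> - pi / 2)"
  define \<beta> where "\<beta> = \<alpha> - h * \<theta>"
  define u u' where "u = dir \<beta>" and "u' = dir (\<beta> - pi / 2)"
  have h: "h * h = 1" "h * (h * z) = z" for z using assms(1) by auto
  have dirs: "dir (\<beta> + pi) = - u" "dir (\<beta> + pi - pi / 2) = - u'"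
    "dir (\<beta> - h * (pi / 2)) = h *\<^sub>R u'" "dir (\<beta> - h * (pi / 2) - pi / 2) = - h *\<^sub>R u"
    using assms(1) by (auto simp: u_def u'_def vec2_eq_iff cos_diff sin_diff cos_add sin_add)
  have "\<alpha> = \<beta> + h * \<theta>" by (simp add: \<beta>_def)
  then have \<alpha>: "dir \<alpha> = cos \<theta> *\<^sub>R u - (h * sin \<theta>) *\<^sub>R u'"
    using assms(1) by (auto simp: u_def u'_def vec2_eq_iff cos_diff sin_diff cos_add sin_add)
  then have C: "C = p + (r * b * cos \<theta>) *\<^sub>R u - (r * b * h * sin \<theta>) *\<^sub>R u'"
    unfolding C_def \<alpha> by (simp add: algebra_simps)
  have F: "F = p + (r * b * cos \<theta>) *\<^sub>R u" by (simp add: F_def u_def \<beta>_def)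
  have "B = p + (r * c) *\<^sub>R u"
    using tri_hypotenuse_vector[OF assms(1), of r \<alpha>]
    by (simp add: B_def C_def u_def \<beta>_def add.assoc)
  \<comment> \<open>The foot cuts the hypotenuse into \<open>AF\<close> and \<open>FB\<close>. In
    this form the second summand is the short leg of the fifth daughter.\<close>
  moreover have "r * b * cos \<theta> + r * sin \<theta> * a = r * c * ((sin \<theta>)\<^sup>2 + (cos \<theta>)\<^sup>2)"
    unfolding ab by algebra
  ultimately have B: "B = p + (r * b * cos \<theta> + r * sin \<theta> * a) *\<^sub>R u" by simp
  note tri = tri_def dirs u_def[symmetric] u'_def[symmetric]
  note sim = C F B M_def \<rho>_def midpoint_def prod_eq_iff vec2_eq_iff
  have "(p, midpoint p F, M) = tri p \<beta> (- h) \<rho>"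
    by (simp only: tri, simp add: sim, simp add: ab algebra_simps h add_divide_distrib diff_divide_distrib)
  moreover have "(M, midpoint F C, C) = tri M \<beta> (- h) \<rho>"
    by (simp only: tri, simp add: sim, simp add: ab algebra_simps h add_divide_distrib diff_divide_distrib)
  moreover have "(M, midpoint F C, F) = tri M \<beta> h \<rho>"
    by (simp only: tri, simp add: sim, simp add: ab algebra_simps h add_divide_distrib diff_divide_distrib)
  moreover have "(F, midpoint p F, M) = tri F (\<beta> + pi) h \<rho>"
    by (simp only: tri, simp add: sim, simp add: ab algebra_simps h add_divide_distrib diff_divide_distrib)
  moreover have "(C, F, B) = tri C (\<beta> - h * (pi / 2)) (- h) (r * sin \<theta>)"
    by (simp only: tri, simp add: sim, simp add: ab algebra_simps h add_divide_distrib diff_divide_distrib)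
  moreover have "daughters (tri p \<alpha> h r) = {(p, midpoint p F, M), (M, midpoint F C, C),
      (M, midpoint F C, F), (F, midpoint p F, M), (C, F, B)}"
    using foot_tri[OF assms(1,2), of p \<alpha>]
    by (simp add: tri_def Let_def C_def F_def M_def B_def)
  ultimately show ?thesis by (simp add: \<beta>_def)
qed

section \<open>Cosets of directions, and similarities acting on tiles\<close>

text \<open>A coset of the group generated by \<theta> and \<open>pi / 2\<close>. The right angle is
  a generator because of the daughter \<open>(C, F, B)\<close>; full turns are contained as well, so
  the ambiguity of angles is harmless.\<close>

definition coset :: "real \<Rightarrow> real set" where
  "coset \<alpha> = {\<alpha> + of_int m * \<theta> + of_int q * (pi / 2) | m q. True}"

lemma coset_self: "\<alpha> \<in> coset \<alpha>"
proof -
  have "\<alpha> = \<alpha> + of_int 0 * \<theta> + of_int 0 * (pi / 2)" by simp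
  then show ?thesis unfolding coset_def by blast
qed

lemma coset_add:
  assumes "\<beta> \<in> coset \<alpha>"
  shows "\<beta> + of_int m * \<theta> + of_int q * (pi / 2) \<in> coset \<alpha>"
proof -
  obtain m' q' where "\<beta> = \<alpha> + of_int m' * \<theta> + of_int q' * (pi / 2)"
    using assms unfolding coset_def by blast
  then have "\<beta> + of_int m * \<theta> + of_int q * (pi / 2)
      = \<alpha> + of_int (m' + m) * \<theta> + of_int (q' + q) * (pi / 2)"
    by (simp add: algebra_simps)
  then show ?thesis unfolding coset_def by blast
qed

text \<open>The unknown angle \<beta> of a motion drops out once the image of one reference
  direction \<gamma> is known: the images of \<gamma> and \<delta> differ by plus or minus
  \<open>\<delta> - \<gamma>\<close>, which lies in the group.\<close>

lemma coset_transport: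
  assumes "\<gamma> \<in> coset \<alpha>" "\<delta> \<in> coset \<alpha>" "k \<in> {1, -1 :: real}" "dir (\<beta> + k * \<gamma>) = dir \<epsilon>"
  shows "\<beta> + k * \<delta> \<in> coset \<epsilon>"
proof -
  obtain m q m' q' where \<gamma>: "\<gamma> = \<alpha> + of_int m * \<theta> + of_int q * (pi / 2)"
    and \<delta>: "\<delta> = \<alpha> + of_int m' * \<theta> + of_int q' * (pi / 2)"
    using assms(1,2) unfolding coset_def by blast
  obtain z :: int where z: "\<beta> + k * \<gamma> = \<epsilon> + 2 * pi * z"
    using assms(4) unfolding dir_eq_iff by blast
  obtain K :: int where K: "k = K"
    using assms(3) sign_of_int by blast
  have "\<beta> + k * \<delta> = (\<beta> + k * \<gamma>) + k * (\<delta> - \<gamma>)" by (simp add: algebra_simps)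
  also have "\<dots> = \<epsilon> + of_int (K * (m' - m)) * \<theta> + of_int (K * (q' - q) + 4 * z) * (pi / 2)"
    unfolding z by (simp add: \<gamma> \<delta> K algebra_simps)
  finally show ?thesis using coset_add[OF coset_self] by metis
qed

lemma daughters_tri_cases:
  assumes "h \<in> {1, -1}" "r > 0" "\<alpha> \<in> coset \<alpha>\<^sub>0" "t \<in> daughters (tri p \<alpha> h r)"
  obtains p' \<alpha>' h' r' where "t = tri p' \<alpha>' h' r'" "h' \<in> {1, -1}" "\<alpha>' \<in> coset \<alpha>\<^sub>0"
    "r' \<in> {r * (cos \<theta> / 2), r * sin \<theta>}"
proof -
  obtain k :: int where k: "h = k"
    using assms(1) sign_of_int by blast
  have "\<alpha> - h * \<theta> \<in> coset \<alpha>\<^sub>0" "\<alpha> - h * \<theta> + pi \<in> coset \<alpha>\<^sub>0" "\<alpha> - h * \<theta> - h * (pi / 2) \<in> coset \<alpha>\<^sub>0"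
    using coset_add[OF assms(3), of "- k" 0] coset_add[OF assms(3), of "- k" 2]
      coset_add[OF assms(3), of "- k" "- k"] by (simp_all add: k)
  moreover have "- h \<in> {1, -1}" using assms(1) by auto
  ultimately show ?thesis
    using assms(4) that assms(1) unfolding daughters_tri[OF assms(1,2)] by blast
qed

text \<open>The lengths of the long legs force equal scales, which then cancel. The angles
  themselves are determined only up to full turns, so the vectors are compared.\<close>

lemma tri_dir_eq:
  assumes "tri p \<alpha> h r = tri p' \<alpha>' h' r'" "r > 0" "r' > 0"
  shows "dir \<alpha> = dir \<alpha>'"
proof -
  have eq: "(r * b) *\<^sub>R dir \<alpha> = (r' * b) *\<^sub>R dir \<alpha>'"
    using assms(1) unfolding tri_def by (metis add_left_imp_eq prod.inject)
  then have "norm ((r * b) *\<^sub>R dir \<alpha>) = norm ((r' * b) *\<^sub>R dir \<alpha>')" by simp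
  then have "r = r'" using assms(2,3) pos by simp
  then show ?thesis using eq assms(2) pos by simp
qed

text \<open>A reflection sends the normal at angle \<open>- (pi / 2)\<close> from the long leg to
  the opposite normal of the image, hence the factor \<open>k\<close> on both the angle and the
  handedness.\<close>

lemma similarity_tri:
  assumes "orthogonal_transformation g" "\<And>\<alpha>. g (dir \<alpha>) = dir (\<beta> + k * \<alpha>)" "k \<in> {1, -1}"
  shows "map_triangle (\<lambda>x. v + \<rho> *\<^sub>R g x) (tri p \<alpha> h r)
    = tri (v + \<rho> *\<^sub>R g p) (\<beta> + k * \<alpha>) (k * h) (\<rho> * r)"
proof -
  have lin: "linear g" using assms(1) by (simp add: orthogonal_transformation_def)
  have "dir (\<beta> + k * (\<alpha> - pi / 2)) = k *\<^sub>R dir (\<beta> + k * \<alpha> - pi / 2)"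
    using assms(3) by (auto simp: vec2_eq_iff cos_diff sin_diff cos_add sin_add)
  then show ?thesis
    by (simp add: tri_def linear_add[OF lin] linear_scale[OF lin] assms(2) scaleR_add_right mult_ac)
qed

lemma motion_tri:
  assumes "euclidean_motion e" "rescaling s"
  obtains k \<rho> v g \<beta> where "k \<in> {1, -1}" "\<rho> > 0"
    "\<forall>p \<alpha> h r. map_triangle (e \<circ> s) (tri p \<alpha> h r)
       = tri (v + \<rho> *\<^sub>R g p) (\<beta> + k * \<alpha>) (k * h) (\<rho> * r)"
proof -
  obtain g v where g: "orthogonal_transformation g" and e: "e = (\<lambda>x. v + g x)"
    using assms(1) by (auto simp: euclidean_motion_def)
  obtain \<rho> where \<rho>: "\<rho> > 0" and s: "s = (\<lambda>x. \<rho> *\<^sub>R x)"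
    using assms(2) by (auto simp: rescaling_def)
  obtain k \<beta> where k: "k \<in> {1, -1}" and "\<forall>\<alpha>. g (dir \<alpha>) = dir (\<beta> + k * \<alpha>)"
    by (rule orthogonal_transformation_dir[OF g])
  then have dir: "g (dir \<alpha>) = dir (\<beta> + k * \<alpha>)" for \<alpha> by blast
  have es: "e \<circ> s = (\<lambda>x. v + \<rho> *\<^sub>R g x)"
    using g by (simp add: fun_eq_iff e s orthogonal_transformation_def linear_scale)
  have "\<forall>p \<alpha> h r. map_triangle (e \<circ> s) (tri p \<alpha> h r)
      = tri (v + \<rho> *\<^sub>R g p) (\<beta> + k * \<alpha>) (k * h) (\<rho> * r)"
    unfolding es by (intro allI similarity_tri[OF g dir k])
  with k \<rho> show ?thesis by (rule that)
qed

text \<open>The sign \<open>h * h\<^sub>0\<close> matches the handedness, the angle is chosen to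
  carry \<open>\<alpha>\<^sub>0\<close> to \<alpha>, and a dilation and a translation do the
  rest.\<close>

lemma has_orientation_exists:
  assumes "h\<^sub>0 \<in> {1, -1}" "h \<in> {1, -1}" "r\<^sub>0 > 0" "r > 0"
  obtains g where "has_orientation (tri p\<^sub>0 \<alpha>\<^sub>0 h\<^sub>0 r\<^sub>0) (tri p \<alpha> h r) g" "g (dir \<alpha>\<^sub>0) = dir \<alpha>"
proof -
  have k: "h * h\<^sub>0 \<in> {1, -1}" using assms(1,2) by auto
  obtain g where g: "orthogonal_transformation g"
    and "\<forall>x. g (dir x) = dir (\<alpha> - h * h\<^sub>0 * \<alpha>\<^sub>0 + h * h\<^sub>0 * x)"
    by (rule orthogonal_transformation_dir_exists[OF k])
  then have dir: "g (dir x) = dir (\<alpha> - h * h\<^sub>0 * \<alpha>\<^sub>0 + h * h\<^sub>0 * x)" for x by blast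
  have h: "h * h\<^sub>0 * h\<^sub>0 = h" using assms(1) by auto
  have "tri p \<alpha> h r = map_triangle (\<lambda>x. (p - (r / r\<^sub>0) *\<^sub>R g p\<^sub>0) + (r / r\<^sub>0) *\<^sub>R g x) (tri p\<^sub>0 \<alpha>\<^sub>0 h\<^sub>0 r\<^sub>0)"
    unfolding similarity_tri[OF g dir k] h using assms(3) by simp
  moreover have "r / r\<^sub>0 > 0" using assms by simp
  ultimately have "has_orientation (tri p\<^sub>0 \<alpha>\<^sub>0 h\<^sub>0 r\<^sub>0) (tri p \<alpha> h r) g"
    unfolding has_orientation_def using g by blast
  then show ?thesis by (rule that) (simp add: dir)
qed

text \<open>Two perpendicular vectors are treated because together their images determine
  \<open>g\<close>.\<close>

lemma has_orientation_dir:
  assumes "has_orientation (tri p\<^sub>0 \<alpha>\<^sub>0 h\<^sub>0 r\<^sub>0) (tri p \<alpha> h r) g" "r\<^sub>0 > 0" "r > 0" "\<alpha> \<in> coset \<epsilon>"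
  shows "g (dir \<alpha>\<^sub>0) \<in> dir ` coset \<epsilon>" "g (dir (\<alpha>\<^sub>0 - pi / 2)) \<in> dir ` coset \<epsilon>"
proof -
  obtain \<rho> v where g: "orthogonal_transformation g" and \<rho>: "\<rho> > 0"
    and t: "tri p \<alpha> h r = map_triangle (\<lambda>x. v + \<rho> *\<^sub>R g x) (tri p\<^sub>0 \<alpha>\<^sub>0 h\<^sub>0 r\<^sub>0)"
    using assms(1) unfolding has_orientation_def by blast
  obtain k \<beta> where k: "k \<in> {1, -1 :: real}" and "\<forall>\<alpha>. g (dir \<alpha>) = dir (\<beta> + k * \<alpha>)"
    by (rule orthogonal_transformation_dir[OF g])
  then have dir: "g (dir \<alpha>) = dir (\<beta> + k * \<alpha>)" for \<alpha> by blast
  have eq: "dir (\<beta> + k * \<alpha>\<^sub>0) = dir \<alpha>"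
    using tri_dir_eq[OF t[unfolded similarity_tri[OF g dir k]]] assms(2,3) \<rho> by simp
  then obtain z :: int where z: "\<beta> + k * \<alpha>\<^sub>0 = \<alpha> + 2 * pi * z" unfolding dir_eq_iff by blast
  show "g (dir \<alpha>\<^sub>0) \<in> dir ` coset \<epsilon>" using assms(4) dir eq by auto
  obtain K :: int where K: "k = K"
    using k sign_of_int by blast
  have "\<beta> + k * (\<alpha>\<^sub>0 - pi / 2) = (\<beta> + k * \<alpha>\<^sub>0) - k * (pi / 2)" by (simp add: algebra_simps)
  also have "\<dots> = \<alpha> + of_int 0 * \<theta> + of_int (4 * z - K) * (pi / 2)"
    unfolding z by (simp add: K algebra_simps)
  finally have "\<beta> + k * (\<alpha>\<^sub>0 - pi / 2) \<in> coset \<epsilon>"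
    by (simp only: coset_add[OF assms(4)])
  then show "g (dir (\<alpha>\<^sub>0 - pi / 2)) \<in> dir ` coset \<epsilon>"
    unfolding dir by (rule imageI)
qed

end

text \<open>Pythagoras yields the square of \<open>cos \<theta>\<close>, and the range of \<theta>
  selects the positive root.\<close>

lemma basic_tileI:
  fixes a b c \<theta> :: real
  assumes "0 < a" "0 < b" "0 < c" "a\<^sup>2 + b\<^sup>2 = c\<^sup>2" "\<theta> = arcsin (a / c)" "0 < \<theta>" "\<theta> < pi / 2"
  shows "basic_tile a b c \<theta>"
proof -
  have 0: "b\<^sup>2 > 0" using \<open>0 < b\<close> by simp
  have 1: "a\<^sup>2 \<le> c\<^sup>2" using 0 unfolding assms(4)[symmetric] by simp
  have 2: "a \<le> c" using 1 less_imp_le[OF \<open>0 < c\<close>] by (rule power2_le_imp_le)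
  have sin: "sin \<theta> = a / c" unfolding assms(5) 
    by (rule sin_arcsin) (use assms(1,3) 2 in \<open>simp_all add: field_simps\<close>)
  have cos: "cos \<theta> = b / c"
  proof (rule power2_eq_imp_eq)
    have "(cos \<theta>)\<^sup>2 = 1 - (a / c)\<^sup>2" unfolding cos_squared_eq sin ..
    also have "\<dots> = (b / c)\<^sup>2"
      using \<open>0 < c\<close> assms(4) by (simp add: power_divide divide_simps)
    finally show "(cos \<theta>)\<^sup>2 = (b / c)\<^sup>2" .
    show "0 \<le> cos \<theta>" using assms(6,7) by (intro cos_ge_zero) auto
    show "0 \<le> b / c" using assms(2,3) by simp
  qed
  show ?thesis
    by unfold_locales (use assms(3,6,7) in \<open>simp_all add: sin cos\<close>)
qed

section \<open>Repeated subdivision: scales, maximal hypotenuses and leaves along a path\<close>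

locale subdivided_tile = basic_tile +
  fixes p\<^sub>0 :: point and \<alpha>\<^sub>0 h\<^sub>0 r\<^sub>0 :: real
  assumes h\<^sub>0: "h\<^sub>0 \<in> {1, -1}" and r\<^sub>0: "r\<^sub>0 > 0"
begin

abbreviation base :: triangle where "base \<equiv> tri p\<^sub>0 \<alpha>\<^sub>0 h\<^sub>0 r\<^sub>0"

definition max_hyp :: "nat \<Rightarrow> real" where
  "max_hyp n = Max (hypotenuse ` subdivision base n)"

lemma subdivision_Suc_cases:
  assumes "t \<in> subdivision base (Suc n)"
  obtains (kept) "t \<in> subdivision base n" "hypotenuse t \<noteq> max_hyp n"
    | (split) u where "u \<in> subdivision base n" "hypotenuse u = max_hyp n" "t \<in> daughters u"
proof -
  from assms obtain u where "u \<in> subdivision base n"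
    and "t \<in> (if hypotenuse u = max_hyp n then daughters u else {u})"
    unfolding subdivision.simps max_hyp_def by blast
  then show ?thesis using that by (cases "hypotenuse u = max_hyp n") auto
qed

text \<open>Each split multiplies the scale by one of two factors; \<open>i\<close> and
  \<open>j\<close> count how often each occurred on the way to the tile. Keeping them as exponents
  makes the possible hypotenuses countable by pairs of naturals.\<close>

lemma subdivision_tri:
  assumes "t \<in> subdivision base n"
  obtains p \<alpha> h i j where "h \<in> {1, -1}" "\<alpha> \<in> coset \<alpha>\<^sub>0"
    "t = tri p \<alpha> h (r\<^sub>0 * (cos \<theta> / 2) ^ i * sin \<theta> ^ j)"
proof -
  have "\<exists>p \<alpha> h i j. h \<in> {1, -1} \<and> \<alpha> \<in> coset \<alpha>\<^sub>0 \<and> t = tri p \<alpha> h (r\<^sub>0 * (cos \<theta> / 2) ^ i * sin \<theta> ^ j)"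
    using assms
  proof (induction n arbitrary: t)
    case 0
    then have "t = tri p\<^sub>0 \<alpha>\<^sub>0 h\<^sub>0 (r\<^sub>0 * (cos \<theta> / 2) ^ 0 * sin \<theta> ^ 0)" by simp
    then show ?case using h\<^sub>0 coset_self by blast
  next
    case (Suc n)
    obtain u where u: "u \<in> subdivision base n" "t = u \<or> t \<in> daughters u"
      using Suc.prems by (metis subdivision_Suc_cases)
    obtain p \<alpha> h i j where h: "h \<in> {1, -1}" and \<alpha>: "\<alpha> \<in> coset \<alpha>\<^sub>0"
      and ueq: "u = tri p \<alpha> h (r\<^sub>0 * (cos \<theta> / 2) ^ i * sin \<theta> ^ j)"
      using Suc.IH[OF u(1)] by blast
    show ?case
    proof (cases "t = u")
      case True
      then show ?thesis using h \<alpha> ueq by blast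
    next
      case False
      define r where "r = r\<^sub>0 * (cos \<theta> / 2) ^ i * sin \<theta> ^ j"
      have "r > 0" using r\<^sub>0 cos_pos sin_pos by (simp add: r_def)
      moreover have "t \<in> daughters (tri p \<alpha> h r)" using False u(2) ueq r_def by simp
      ultimately obtain p' \<alpha>' h' r' where t: "t = tri p' \<alpha>' h' r'" "h' \<in> {1, -1}" "\<alpha>' \<in> coset \<alpha>\<^sub>0"
        and r': "r' \<in> {r * (cos \<theta> / 2), r * sin \<theta>}"
        using daughters_tri_cases[OF h _ \<alpha>] by blast
      have "r' = r\<^sub>0 * (cos \<theta> / 2) ^ Suc i * sin \<theta> ^ j \<or> r' = r\<^sub>0 * (cos \<theta> / 2) ^ i * sin \<theta> ^ Suc j"
        using r' by (auto simp: r_def)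
      then show ?thesis using t by blast
    qed
  qed
  then show ?thesis using that by blast
qed

lemma scale_pos: "r\<^sub>0 * (cos \<theta> / 2) ^ i * sin \<theta> ^ j > 0"
  using r\<^sub>0 cos_pos sin_pos by simp

lemma finite_subdivision: "finite (subdivision base n)"
proof (induction n)
  case (Suc n)
  moreover have "finite (daughters t)" for t by (cases t) (auto simp: Let_def)
  ultimately show ?case by auto
qed simp

lemma subdivision_nonempty: "subdivision base n \<noteq> {}"
proof (induction n)
  case (Suc n)
  moreover have "daughters t \<noteq> {}" for t by (cases t) (auto simp: Let_def)
  ultimately show ?case by auto
qed simp

lemma hypotenuse_le_max: "t \<in> subdivision base n \<Longrightarrow> hypotenuse t \<le> max_hyp n"
  unfolding max_hyp_def using finite_subdivision by simp

lemma max_hyp_attained: obtains t where "t \<in> subdivision base n" "hypotenuse t = max_hyp n"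
proof -
  have "max_hyp n \<in> hypotenuse ` subdivision base n"
    unfolding max_hyp_def using finite_subdivision subdivision_nonempty by (intro Max_in) auto
  then show ?thesis using that by auto
qed

text \<open>Every tile of maximal hypotenuse is split, and both factors
  \<open>cos \<theta> / 2\<close> and \<open>sin \<theta>\<close> are below 1. A tile of the next
  stage is thus a smaller old tile or a strictly smaller daughter.\<close>

lemma max_hyp_Suc_less: "max_hyp (Suc n) < max_hyp n"
proof -
  obtain t where t: "t \<in> subdivision base (Suc n)" and eq: "hypotenuse t = max_hyp (Suc n)"
    by (rule max_hyp_attained)
  from t show ?thesis
  proof (cases rule: subdivision_Suc_cases)
    case kept
    then show ?thesis using hypotenuse_le_max eq by fastforce
  next
    case (split u)
    obtain p \<alpha> h i j where h: "h \<in> {1, -1}" and \<alpha>: "\<alpha> \<in> coset \<alpha>\<^sub>0"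
      and ueq: "u = tri p \<alpha> h (r\<^sub>0 * (cos \<theta> / 2) ^ i * sin \<theta> ^ j)"
      by (rule subdivision_tri[OF split(1)]) (rule that, assumption+)
    define r where "r = r\<^sub>0 * (cos \<theta> / 2) ^ i * sin \<theta> ^ j"
    have r: "r > 0" using scale_pos by (simp add: r_def)
    have "t \<in> daughters (tri p \<alpha> h r)" using split(3) ueq r_def by simp
    then obtain p' \<alpha>' h' r' where t: "t = tri p' \<alpha>' h' r'" and h': "h' \<in> {1, -1}"
      and r': "r' \<in> {r * (cos \<theta> / 2), r * sin \<theta>}"
      using daughters_tri_cases[OF h r \<alpha>] by blast
    have "r * (cos \<theta> / 2) > 0" "r * sin \<theta> > 0" using r cos_pos sin_pos by simp_all
    then have "r' > 0" using r' by (elim insertE emptyE) (simp_all only:)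
    have "cos \<theta> / 2 < 1" using cos_le_one[of \<theta>] by linarith
    then have "r * (cos \<theta> / 2) < r" "r * sin \<theta> < r"
      using r sin_less_1 by simp_all
    then have "r' < r" using r' by (elim insertE emptyE) (simp_all only:)
    then have "hypotenuse t < hypotenuse u"
      using c unfolding t ueq r_def[symmetric] hypotenuse_tri[OF h' \<open>r' > 0\<close>] hypotenuse_tri[OF h r]
      by simp
    then show ?thesis using split(2) eq by simp
  qed
qed

lemma max_hyp_antimono: "m < n \<Longrightarrow> max_hyp n < max_hyp m"
  using lift_Suc_mono_less[of "\<lambda>n. - max_hyp n" m n] max_hyp_Suc_less by simp

text \<open>Only finitely many hypotenuse lengths exceed a given bound, and \<open>max_hyp\<close> strictly decreases.\<close>

lemma max_hyp_small:
  assumes "\<epsilon> > 0"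
  obtains n where "max_hyp n < \<epsilon>"
proof (rule ccontr)
  assume *: "\<not> thesis"
  have ge: "\<epsilon> \<le> max_hyp n" for n by (meson * not_less that)
  have c2: "0 < cos \<theta> / 2" "cos \<theta> / 2 < 1" using cos_pos cos_le_one[of \<theta>] by linarith+
  have rc: "r\<^sub>0 * c > 0" using r\<^sub>0 c by simp
  \<comment> \<open>\<epsilon> measured in units of the hypotenuse of the base tile.\<close>
  define \<delta> where "\<delta> = \<epsilon> / (r\<^sub>0 * c)"
  have "\<delta> > 0" using assms rc by (simp add: \<delta>_def)
  obtain I where I: "(cos \<theta> / 2) ^ I < \<delta>" using real_arch_pow_inv[OF \<open>\<delta> > 0\<close> c2(2)] by blast
  obtain J where J: "sin \<theta> ^ J < \<delta>" using real_arch_pow_inv[OF \<open>\<delta> > 0\<close> sin_less_1] by blast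
  \<comment> \<open>Both powers are at most 1, so a product of at least \<delta> forces each of them
    to be at least \<delta>; this bounds \<open>i\<close> by \<open>I\<close> and \<open>j\<close>
    by \<open>J\<close>.\<close>
  have "range max_hyp \<subseteq> (\<lambda>(i, j). r\<^sub>0 * (cos \<theta> / 2) ^ i * sin \<theta> ^ j * c) ` ({..<I} \<times> {..<J})"
  proof clarify
    fix n
    obtain t where t: "t \<in> subdivision base n" and hyp: "hypotenuse t = max_hyp n"
      by (rule max_hyp_attained)
    obtain p \<alpha> h i j where h: "h \<in> {1, -1}"
      and teq: "t = tri p \<alpha> h (r\<^sub>0 * (cos \<theta> / 2) ^ i * sin \<theta> ^ j)"
      by (rule subdivision_tri[OF t]) (rule that, assumption+)
    have M: "max_hyp n = r\<^sub>0 * (cos \<theta> / 2) ^ i * sin \<theta> ^ j * c"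
      using hyp hypotenuse_tri[OF h scale_pos] by (simp only: teq)
    have "\<delta> * (r\<^sub>0 * c) \<le> ((cos \<theta> / 2) ^ i * sin \<theta> ^ j) * (r\<^sub>0 * c)"
      using ge[of n] rc r\<^sub>0 c unfolding M \<delta>_def by (simp add: mult_ac)
    then have le: "\<delta> \<le> (cos \<theta> / 2) ^ i * sin \<theta> ^ j" using rc by (simp only: mult_le_cancel_right_pos)
    have x: "0 < (cos \<theta> / 2) ^ i" "(cos \<theta> / 2) ^ i \<le> 1"
      using c2 by (auto intro: power_le_one simp del: power_divide)
    have y: "0 < sin \<theta> ^ j" "sin \<theta> ^ j \<le> 1"
      using sin_pos sin_less_1 by (auto intro: power_le_one)
    have "\<delta> \<le> (cos \<theta> / 2) ^ i" using le mult_left_le[OF y(2), of "(cos \<theta> / 2) ^ i"] x by linarith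
    then have "(cos \<theta> / 2) ^ I < (cos \<theta> / 2) ^ i" using I by linarith
    then have "i < I" using c2 by (simp only: power_strict_decreasing_iff)
    have "\<delta> \<le> sin \<theta> ^ j" using le mult_left_le_one_le[of "sin \<theta> ^ j" "(cos \<theta> / 2) ^ i"] x y by linarith
    then have "sin \<theta> ^ J < sin \<theta> ^ j" using J by linarith
    then have "j < J" using sin_pos sin_less_1 by (simp only: power_strict_decreasing_iff)
    show "max_hyp n \<in> (\<lambda>(i, j). r\<^sub>0 * (cos \<theta> / 2) ^ i * sin \<theta> ^ j * c) ` ({..<I} \<times> {..<J})"
      unfolding M using \<open>i < I\<close> \<open>j < J\<close> by (intro image_eqI[where x = "(i, j)"]) auto
  qed
  then have "finite (range max_hyp)" by (rule finite_subset) simp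
  moreover have "inj max_hyp"
    by (rule linorder_injI) (use max_hyp_antimono in fastforce)
  ultimately show False using finite_imageD infinite_UNIV_nat by blast
qed

text \<open>Follow the daughter \<open>(M, K, F)\<close> \<open>j\<close> times, turning by \<open>\<theta>\<close> in the same sense, and
  \<open>(A, N, M)\<close> from then on, where the turns alternate; both shrink by \<open>cos \<theta> / 2\<close>.\<close>

lemma leaf_on_path:
  "\<exists>k p \<alpha> h. tri p \<alpha> h (r\<^sub>0 * (cos \<theta> / 2) ^ k) \<in> subdivision base n \<and>
     (k \<le> j \<and> h = h\<^sub>0 \<and> \<alpha> = \<alpha>\<^sub>0 - k * h\<^sub>0 * \<theta> \<or>
      k \<ge> j \<and> (h = h\<^sub>0 \<and> \<alpha> = \<alpha>\<^sub>0 - j * h\<^sub>0 * \<theta> \<or> h = - h\<^sub>0 \<and> \<alpha> = \<alpha>\<^sub>0 - Suc j * h\<^sub>0 * \<theta>))"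
  (is "\<exists>k p \<alpha> h. _ \<and> ?inv k \<alpha> h")
proof (induction n)
  case 0
  show ?case by (intro exI[of _ 0] exI[of _ p\<^sub>0] exI[of _ \<alpha>\<^sub>0] exI[of _ h\<^sub>0]) simp
next
  case (Suc n)
  then obtain k p \<alpha> h where t: "tri p \<alpha> h (r\<^sub>0 * (cos \<theta> / 2) ^ k) \<in> subdivision base n"
    and inv: "?inv k \<alpha> h" by blast
  define r where "r = r\<^sub>0 * (cos \<theta> / 2) ^ k"
  have r: "r > 0" using scale_pos[of k 0] by (simp add: r_def)
  have h: "h \<in> {1, -1}" using inv h\<^sub>0 by auto
  show ?case
  proof (cases "hypotenuse (tri p \<alpha> h r) = max_hyp n")
    case True
    then have sub: "daughters (tri p \<alpha> h r) \<subseteq> subdivision base (Suc n)"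
      using t by (force simp: r_def max_hyp_def)
    have r_Suc: "r * (cos \<theta> / 2) = r\<^sub>0 * (cos \<theta> / 2) ^ Suc k" by (simp add: r_def)
    obtain p' p'' where
      d: "tri p' (\<alpha> - h * \<theta>) (- h) (r\<^sub>0 * (cos \<theta> / 2) ^ Suc k) \<in> subdivision base (Suc n)"
        "tri p'' (\<alpha> - h * \<theta>) h (r\<^sub>0 * (cos \<theta> / 2) ^ Suc k) \<in> subdivision base (Suc n)"
      using sub unfolding daughters_tri[OF h r] r_Suc by blast
    show ?thesis
    proof (cases "k < j")
      case True
      then have "?inv (Suc k) (\<alpha> - h * \<theta>) h" using inv by (auto simp: algebra_simps)
      then show ?thesis using d(2) by blast
    next
      \<comment> \<open>Here \<open>k \<ge> j\<close>. A tile of handedness \<open>h\<^sub>0\<close>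
        moves on to \<open>Suc j\<close> turns with flipped handedness, and its flipped daughter
        turns back to \<open>j\<close>, so the invariant has period two from here on.\<close>
      case False
      then have "?inv (Suc k) (\<alpha> - h * \<theta>) (- h)" using inv by (auto simp: algebra_simps)
      then show ?thesis using d(1) by blast
    qed
  next
    \<comment> \<open>A tile below the maximal size is kept, so \<open>k\<close> counts the splits
      on the path rather than the stages.\<close>
    case False
    then have "tri p \<alpha> h r \<in> subdivision base (Suc n)"
      using t by (auto simp: r_def max_hyp_def intro!: bexI)
    then show ?thesis using inv unfolding r_def by blast
  qed
qed

text \<open>Once all hypotenuses are below that of a tile of scale
  \<open>r\<^sub>0 * (cos \<theta> / 2) ^ K\<close>, the leaf of every path has been split more than
  \<open>K\<close> times. It is then past the switch for each \<open>j \<le> K\<close>, so one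
  \<open>n\<^sub>0\<close> serves all these \<open>j\<close>.\<close>

lemma many_leaves:
  obtains n\<^sub>0 where "\<forall>n j. n\<^sub>0 \<le> n \<longrightarrow> j \<le> K \<longrightarrow>
    (\<exists>m p h r. m \<in> {j, Suc j} \<and> h \<in> {1, -1} \<and> r > 0 \<and> tri p (\<alpha>\<^sub>0 - m * h\<^sub>0 * \<theta>) h r \<in> subdivision base n)"
proof -
  have c2: "0 < cos \<theta> / 2" "cos \<theta> / 2 < 1" using cos_pos cos_le_one[of \<theta>] by linarith+
  have rK: "r\<^sub>0 * (cos \<theta> / 2) ^ k > 0" for k using scale_pos[of k 0] by simp
  have "r\<^sub>0 * (cos \<theta> / 2) ^ K * c > 0" using rK c by (simp del: power_divide)
  then obtain n\<^sub>0 where n\<^sub>0: "max_hyp n\<^sub>0 < r\<^sub>0 * (cos \<theta> / 2) ^ K * c" by (rule max_hyp_small)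
  show ?thesis
  proof (rule that, intro allI impI)
    fix n j assume "n \<ge> n\<^sub>0" "j \<le> K"
    obtain k p \<alpha> h where t: "tri p \<alpha> h (r\<^sub>0 * (cos \<theta> / 2) ^ k) \<in> subdivision base n"
      and inv: "k \<le> j \<and> h = h\<^sub>0 \<and> \<alpha> = \<alpha>\<^sub>0 - k * h\<^sub>0 * \<theta> \<or>
        k \<ge> j \<and> (h = h\<^sub>0 \<and> \<alpha> = \<alpha>\<^sub>0 - j * h\<^sub>0 * \<theta> \<or> h = - h\<^sub>0 \<and> \<alpha> = \<alpha>\<^sub>0 - Suc j * h\<^sub>0 * \<theta>)"
      using leaf_on_path[of n j] by blast
    have h: "h \<in> {1, -1}" using inv h\<^sub>0 by auto
    have "max_hyp n \<le> max_hyp n\<^sub>0"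
      using max_hyp_antimono[of n\<^sub>0 n] \<open>n \<ge> n\<^sub>0\<close> by (cases "n = n\<^sub>0") auto
    then have "r\<^sub>0 * (cos \<theta> / 2) ^ k * c < r\<^sub>0 * (cos \<theta> / 2) ^ K * c"
      using hypotenuse_le_max[OF t] n\<^sub>0 unfolding hypotenuse_tri[OF h rK] by linarith
    then have "(cos \<theta> / 2) ^ k < (cos \<theta> / 2) ^ K"
      using r\<^sub>0 c by (simp del: power_divide)
    then have "K < k" using c2 by (simp only: power_strict_decreasing_iff)
    then have "\<alpha> = \<alpha>\<^sub>0 - j * h\<^sub>0 * \<theta> \<or> \<alpha> = \<alpha>\<^sub>0 - Suc j * h\<^sub>0 * \<theta>"
      using inv \<open>j \<le> K\<close> by auto
    then show "\<exists>m p h r. m \<in> {j, Suc j} \<and> h \<in> {1, -1} \<and> r > 0 \<and>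
        tri p (\<alpha>\<^sub>0 - m * h\<^sub>0 * \<theta>) h r \<in> subdivision base n"
      using t h rK by blast
  qed
qed

section \<open>Directions in supertiles and the number of orientations\<close>

text \<open>On directions the motion acts only through \<open>k\<close> and \<beta>. The second
  conclusion confines the directions of a supertile and serves the rational case; the third carries
  leaves over to it and serves the irrational case.\<close>

lemma supertile_tri:
  assumes "supertile base n S"
  obtains k \<beta> where "k \<in> {1, -1 :: real}"
    "\<forall>t\<in>S. \<exists>p \<alpha> h r. r > 0 \<and> \<alpha> \<in> coset \<alpha>\<^sub>0 \<and> t = tri p (\<beta> + k * \<alpha>) h r"
    "\<forall>p \<alpha> h r. tri p \<alpha> h r \<in> subdivision base n \<longrightarrow> h \<in> {1, -1} \<longrightarrow> r > 0 \<longrightarrow>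
       (\<exists>p' h' r'. h' \<in> {1, -1} \<and> r' > 0 \<and> tri p' (\<beta> + k * \<alpha>) h' r' \<in> S)"
proof -
  obtain e s where e: "euclidean_motion e" "rescaling s"
    and S: "S = map_triangle (e \<circ> s) ` subdivision base n"
    using assms unfolding supertile_def by blast
  obtain k \<rho> v g \<beta> where k: "k \<in> {1, -1}" and \<rho>: "\<rho> > 0"
    and "\<forall>p \<alpha> h r. map_triangle (e \<circ> s) (tri p \<alpha> h r)
      = tri (v + \<rho> *\<^sub>R g p) (\<beta> + k * \<alpha>) (k * h) (\<rho> * r)"
    by (rule motion_tri[OF e]) (rule that, assumption+)
  then have m: "map_triangle (e \<circ> s) (tri p \<alpha> h r)
      = tri (v + \<rho> *\<^sub>R g p) (\<beta> + k * \<alpha>) (k * h) (\<rho> * r)" for p \<alpha> h r by blast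
  have "\<exists>p \<alpha> h r. r > 0 \<and> \<alpha> \<in> coset \<alpha>\<^sub>0 \<and> t = tri p (\<beta> + k * \<alpha>) h r" if t: "t \<in> S" for t
  proof -
    obtain u where u: "u \<in> subdivision base n" "t = map_triangle (e \<circ> s) u"
      using t unfolding S by blast
    obtain p \<alpha> h i j where "\<alpha> \<in> coset \<alpha>\<^sub>0" "u = tri p \<alpha> h (r\<^sub>0 * (cos \<theta> / 2) ^ i * sin \<theta> ^ j)"
      by (rule subdivision_tri[OF u(1)]) (rule that, assumption+)
    moreover have "\<rho> * (r\<^sub>0 * (cos \<theta> / 2) ^ i * sin \<theta> ^ j) > 0"
      using \<rho> scale_pos by (rule mult_pos_pos)
    ultimately show ?thesis using m u(2) by blast
  qed
  moreover have "\<exists>p' h' r'. h' \<in> {1, -1} \<and> r' > 0 \<and> tri p' (\<beta> + k * \<alpha>) h' r' \<in> S"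
    if "tri p \<alpha> h r \<in> subdivision base n" "h \<in> {1, -1}" "r > 0" for p \<alpha> h r
  proof -
    have "k * h \<in> {1, -1}" using k that(2) by auto
    moreover have "\<rho> * r > 0" using \<rho> that(3) by simp
    moreover have "tri (v + \<rho> *\<^sub>R g p) (\<beta> + k * \<alpha>) (k * h) (\<rho> * r) \<in> S"
      unfolding S m[symmetric] using that(1) by (rule imageI)
    ultimately show ?thesis by blast
  qed
  ultimately show ?thesis using k by (intro that[of k \<beta>]) blast+
qed

text \<open>A tile of \<open>S 0\<close> lies in every \<open>S i\<close> and ties the unknown motions together.\<close>

lemma finite_orientations:
  fixes S :: "nat \<Rightarrow> triangle set"
  assumes rat: "\<theta> / pi \<in> \<rat>" and super: "\<And>i. supertile base (N i) (S i)" and chain: "\<And>i. S i \<subseteq> S (Suc i)"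
  shows "finite (orientations base (\<Union>i. S i))"
proof -
  have S0: "S 0 \<subseteq> S i" for i using lift_Suc_mono_le[of S 0 i] chain by simp
  have "S 0 \<noteq> {}"
    using super[of 0] subdivision_nonempty by (auto simp: supertile_def)
  then obtain t\<^sub>0 where t\<^sub>0: "t\<^sub>0 \<in> S 0" by blast
  obtain k\<^sub>0 \<beta>\<^sub>0 where
    "\<forall>t\<in>S 0. \<exists>p \<alpha> h r. r > 0 \<and> \<alpha> \<in> coset \<alpha>\<^sub>0 \<and> t = tri p (\<beta>\<^sub>0 + k\<^sub>0 * \<alpha>) h r"
    by (rule supertile_tri[OF super[of 0]]) (rule that, assumption+)
  then obtain p\<^sub>1 \<epsilon> h\<^sub>1 r\<^sub>1 where t\<^sub>0_eq: "t\<^sub>0 = tri p\<^sub>1 \<epsilon> h\<^sub>1 r\<^sub>1" and r\<^sub>1: "r\<^sub>1 > 0"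
    using t\<^sub>0 by blast
  have tile: "\<exists>p \<alpha> h r. r > 0 \<and> \<alpha> \<in> coset \<epsilon> \<and> t = tri p \<alpha> h r" if t: "t \<in> S i" for t i
  proof -
    obtain k \<beta> where k: "k \<in> {1, -1 :: real}"
      and all: "\<forall>t\<in>S i. \<exists>p \<alpha> h r. r > 0 \<and> \<alpha> \<in> coset \<alpha>\<^sub>0 \<and> t = tri p (\<beta> + k * \<alpha>) h r"
      by (rule supertile_tri[OF super[of i]]) (rule that, assumption+)
    obtain p \<alpha> h r where r: "r > 0" and \<alpha>: "\<alpha> \<in> coset \<alpha>\<^sub>0" and t_eq: "t = tri p (\<beta> + k * \<alpha>) h r"
      using all t by blast
    \<comment> \<open>Since \<open>t\<^sub>0\<close> also lies in \<open>S i\<close>, the same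
      \<open>k\<close> and \<beta> describe it, and its known direction \<epsilon> eliminates
      them.\<close>
    obtain p' \<alpha>' h' r' where r': "r' > 0" and \<alpha>': "\<alpha>' \<in> coset \<alpha>\<^sub>0" and "t\<^sub>0 = tri p' (\<beta> + k * \<alpha>') h' r'"
      using all t\<^sub>0 S0 by blast
    then have "dir (\<beta> + k * \<alpha>') = dir \<epsilon>"
      using tri_dir_eq[OF _ r' r\<^sub>1] t\<^sub>0_eq by metis
    then have "\<beta> + k * \<alpha> \<in> coset \<epsilon>" by (rule coset_transport[OF \<alpha>' \<alpha> k])
    then show ?thesis using r t_eq by blast
  qed
  define D where "D = dir ` coset \<epsilon>"
  have "D = {dir (\<epsilon> + of_int m * \<theta> + of_int q * (pi / 2)) | m q. True}"
    unfolding D_def coset_def by blast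
  then have "finite D" using finite_dir_coset[OF rat] by simp
  \<comment> \<open>An orientation is encoded by its values on an orthonormal basis; the code is
    injective by linearity and takes values in a finite set.\<close>
  define \<Phi> where "\<Phi> g = (g (dir \<alpha>\<^sub>0), g (dir (\<alpha>\<^sub>0 - pi / 2)))" for g :: "point \<Rightarrow> point"
  have "\<Phi> ` orientations base (\<Union>i. S i) \<subseteq> D \<times> D"
  proof (rule image_subsetI)
    fix g assume "g \<in> orientations base (\<Union>i. S i)"
    then obtain t i where t: "t \<in> S i" and o: "has_orientation base t g"
      unfolding orientations_def by blast
    obtain p \<alpha> h r where r: "r > 0" and \<alpha>: "\<alpha> \<in> coset \<epsilon>" and t_eq: "t = tri p \<alpha> h r"
      using tile[OF t] by blast
    show "\<Phi> g \<in> D \<times> D"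
      using has_orientation_dir[OF o[unfolded t_eq] r\<^sub>0 r \<alpha>] by (simp add: \<Phi>_def D_def)
  qed
  then have "finite (\<Phi> ` orientations base (\<Union>i. S i))"
    using \<open>finite D\<close> by (meson finite_SigmaI finite_subset)
  moreover have "inj_on \<Phi> (orientations base (\<Union>i. S i))"
  proof (rule inj_onI)
    fix f g assume "f \<in> orientations base (\<Union>i. S i)" "g \<in> orientations base (\<Union>i. S i)" and eq: "\<Phi> f = \<Phi> g"
    then have lin: "linear f" "linear g"
      by (auto simp: orientations_def has_orientation_def orthogonal_transformation_def)
    show "f = g"
    proof
      fix v :: point
      obtain x y where v: "v = x *\<^sub>R dir \<alpha>\<^sub>0 + y *\<^sub>R dir (\<alpha>\<^sub>0 - pi / 2)"
        by (rule that[OF expand_dir])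
      show "f v = g v"
        using eq unfolding v by (simp add: \<Phi>_def linear_add[OF lin(1)] linear_add[OF lin(2)]
            linear_scale[OF lin(1)] linear_scale[OF lin(2)])
    qed
  qed
  ultimately show ?thesis by (rule finite_imageD)
qed

text \<open>Finitely many orientations would leave a finite set \<open>E\<close> of long leg
  directions, yet a single late supertile shows \<open>card E + 1\<close> distinct ones.\<close>

lemma infinite_orientations:
  fixes S :: "nat \<Rightarrow> triangle set"
  assumes irrat: "\<theta> / pi \<notin> \<rat>" and super: "\<And>i. supertile base (N i) (S i)" and N: "strict_mono N"
  shows "infinite (orientations base (\<Union>i. S i))"
proof
  assume fin: "finite (orientations base (\<Union>i. S i))"
  define E where "E = (\<lambda>g. g (dir \<alpha>\<^sub>0)) ` orientations base (\<Union>i. S i)"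
  have "finite E" using fin by (simp add: E_def)
  have E: "dir \<alpha> \<in> E" if t: "tri p \<alpha> h r \<in> S i" and h: "h \<in> {1, -1}" and r: "r > 0" for p \<alpha> h r i
  proof -
    obtain g where g: "has_orientation base (tri p \<alpha> h r) g" "g (dir \<alpha>\<^sub>0) = dir \<alpha>"
      by (rule has_orientation_exists[OF h\<^sub>0 h r\<^sub>0 r])
    have "g \<in> orientations base (\<Union>i. S i)"
      using g(1) t unfolding orientations_def by blast
    then show ?thesis unfolding E_def g(2)[symmetric] by (rule imageI)
  qed
  \<comment> \<open>Each leaf is known only to have turned \<open>j\<close> or \<open>Suc j\<close>
    times. Taking \<open>j = 2 * l\<close> for \<open>l \<le> card E\<close> makes these pairs
    disjoint, hence the bound \<open>2 * card E\<close>.\<close>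
  obtain n\<^sub>0 where n\<^sub>0: "\<forall>n j. n\<^sub>0 \<le> n \<longrightarrow> j \<le> 2 * card E \<longrightarrow>
    (\<exists>m p h r. m \<in> {j, Suc j} \<and> h \<in> {1, -1} \<and> r > 0 \<and> tri p (\<alpha>\<^sub>0 - m * h\<^sub>0 * \<theta>) h r \<in> subdivision base n)"
    by (rule many_leaves) (rule that, assumption+)
  \<comment> \<open>The supertile with index \<open>n\<^sub>0\<close> thus has an order large enough
    for all the leaves.\<close>
  have "n\<^sub>0 \<le> N n\<^sub>0" using N by (rule strict_mono_imp_increasing)
  obtain k \<beta> where k: "k \<in> {1, -1 :: real}"
    and all: "\<forall>p \<alpha> h r. tri p \<alpha> h r \<in> subdivision base (N n\<^sub>0) \<longrightarrow> h \<in> {1, -1} \<longrightarrow> r > 0 \<longrightarrow>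
       (\<exists>p' h' r'. h' \<in> {1, -1} \<and> r' > 0 \<and> tri p' (\<beta> + k * \<alpha>) h' r' \<in> S n\<^sub>0)"
    by (rule supertile_tri[OF super[of n\<^sub>0]]) (rule that, assumption+)
  have "\<exists>m. m div 2 = l \<and> dir (\<beta> + k * (\<alpha>\<^sub>0 - m * h\<^sub>0 * \<theta>)) \<in> E" if l: "l \<le> card E" for l :: nat
  proof -
    have "2 * l \<le> 2 * card E" using l by simp
    note leaf = n\<^sub>0[rule_format, OF \<open>n\<^sub>0 \<le> N n\<^sub>0\<close> this]
    obtain m p h r where m: "m \<in> {2 * l, Suc (2 * l)}" and h: "h \<in> {1, -1}" and r: "r > 0"
      and "tri p (\<alpha>\<^sub>0 - m * h\<^sub>0 * \<theta>) h r \<in> subdivision base (N n\<^sub>0)"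
      using leaf by blast
    then obtain p' h' r' where "h' \<in> {1, -1}" "r' > 0"
      "tri p' (\<beta> + k * (\<alpha>\<^sub>0 - m * h\<^sub>0 * \<theta>)) h' r' \<in> S n\<^sub>0"
      using all by blast
    then have "dir (\<beta> + k * (\<alpha>\<^sub>0 - m * h\<^sub>0 * \<theta>)) \<in> E" using E by blast
    moreover have "m div 2 = l" using m by auto
    ultimately show ?thesis by blast
  qed
  then obtain m :: "nat \<Rightarrow> nat" where m: "\<And>l. l \<le> card E \<Longrightarrow> m l div 2 = l"
    and mE: "\<And>l. l \<le> card E \<Longrightarrow> dir (\<beta> + k * (\<alpha>\<^sub>0 - m l * h\<^sub>0 * \<theta>)) \<in> E"
    by metis
  define f where "f l = dir (\<beta> + k * (\<alpha>\<^sub>0 - m l * h\<^sub>0 * \<theta>))" for l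
  have "inj_on f {..card E}"
  proof (rule inj_onI)
    fix l l' assume l: "l \<in> {..card E}" "l' \<in> {..card E}" and "f l = f l'"
    then obtain z :: int where
      z: "\<beta> + k * (\<alpha>\<^sub>0 - m l * h\<^sub>0 * \<theta>) = \<beta> + k * (\<alpha>\<^sub>0 - m l' * h\<^sub>0 * \<theta>) + 2 * pi * z"
      unfolding f_def dir_eq_iff by blast
    have kh: "(k * h\<^sub>0) * (k * h\<^sub>0) = 1" using k h\<^sub>0 by auto
    have "k * h\<^sub>0 \<in> {1, -1}" using k h\<^sub>0 by auto
    then obtain K :: int where K: "k * h\<^sub>0 = K" using sign_of_int by blast
    define d where "d = real (m l') - real (m l)"
    have "(k * h\<^sub>0) * (d * \<theta>) = 2 * pi * z"
      using z by (simp add: d_def algebra_simps)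
    then have "((k * h\<^sub>0) * (k * h\<^sub>0)) * (d * \<theta>) = 2 * pi * (K * z)"
      using K by (simp add: algebra_simps)
    then have d\<theta>: "d * \<theta> = 2 * pi * (K * z)" by (simp only: kh mult_1)
    \<comment> \<open>Otherwise dividing by \<open>d\<close> would exhibit
      \<open>\<theta> / pi\<close> as a quotient of rationals.\<close>
    have "d = 0"
    proof (rule ccontr)
      assume "d \<noteq> 0"
      then have "\<theta> / pi = of_int (2 * (K * z)) / d"
        using d\<theta> by (simp add: field_simps)
      moreover have "d \<in> \<rat>" by (simp add: d_def)
      ultimately have "\<theta> / pi \<in> \<rat>" by (metis Rats_divide Rats_of_int)
      then show False using irrat by simp
    qed
    then have "m l = m l'" by (simp add: d_def)
    \<comment> \<open>The pair containing \<open>m l\<close> determines \<open>l\<close> through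
      division by 2.\<close>
    then show "l = l'" using m l by (metis atMost_iff)
  qed
  moreover have "f ` {..card E} \<subseteq> E" using mE by (auto simp: f_def)
  ultimately have "card {..card E} \<le> card E" using \<open>finite E\<close> by (rule card_inj_on_le)
  then show False by simp
qed

end

theorem theorem2:
  fixes a b c \<theta> :: real and T :: triangle and X :: "triangle set"
  assumes "0 < a" "0 < b" "0 < c" "a\<^sup>2 + b\<^sup>2 = c\<^sup>2"
    and "\<theta> = arcsin (a / c)" "0 < \<theta>" "\<theta> < pi / 2"
    and "is_tile a b c T" "hypotenuse T = c"
    and "hierarchical_tiling a b c T X"
  shows "(\<theta> / pi \<in> \<rat> \<longrightarrow> finite (orientations T X)) \<and>
         (\<theta> / pi \<notin> \<rat> \<longrightarrow> infinite (orientations T X))"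
proof -
  interpret basic_tile a b c \<theta>
    by (rule basic_tileI) (fact assms)+
  obtain p\<^sub>0 \<alpha>\<^sub>0 h\<^sub>0 r\<^sub>0 where h\<^sub>0: "h\<^sub>0 \<in> {1, -1}" and r\<^sub>0: "r\<^sub>0 > 0" and T: "T = tri p\<^sub>0 \<alpha>\<^sub>0 h\<^sub>0 r\<^sub>0"
    by (rule is_tile_tri[OF assms(8)]) (rule that, assumption+)
  interpret subdivided_tile a b c \<theta> p\<^sub>0 \<alpha>\<^sub>0 h\<^sub>0 r\<^sub>0
    by unfold_locales (rule h\<^sub>0 r\<^sub>0)+
  obtain S :: "nat \<Rightarrow> triangle set" and N :: "nat \<Rightarrow> nat" where X: "X = (\<Union>i. S i)" and N: "strict_mono N"
    and super: "\<forall>i. supertile T (N i) (S i)" and chain: "\<forall>i. S i \<subset> S (Suc i)"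
    using assms(10) unfolding hierarchical_tiling_def by (elim conjE exE) (rule that, assumption+)
  have super': "supertile base (N i) (S i)" for i using super unfolding T by blast
  have chain': "S i \<subseteq> S (Suc i)" for i using chain by blast
  show ?thesis
    unfolding X T
    using finite_orientations[where S = S and N = N, OF _ super' chain']
      infinite_orientations[where S = S and N = N, OF _ super' N] by blast
qed

end
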